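(* The positive definite matrix $\mathbf{J}_{[2]}-c\mathbf{I}$ can be factorised as $$\mathbf{J}_{[2]}-c\mathbf{I}=\mathbf{R}\mathbf{Q},$$ where $\mathbf{R}$ is an upper triangular (semi-infinite) matrix and $\mathbf{Q}$ is an orthogonal (semi-infinite) matrix, i.e. $\mathbf{Q}\mathbf{Q}^\intercal=\mathbf{Q}^\intercal\mathbf{Q}=\mathbf{I}$.
   Context: $\mu$ is a positive Borel measure with infinite support contained in an interval $E\subseteq\mathbb{R}$ (bounded or unbounded), with all moments finite, and $c\in\mathbb{R}\setminus E$ lies to the left of $E$. $\bar{\mathbf{p}}^{[2]}=[p_0^{[2]},p_1^{[2]},\dots]^\intercal$ is the vector of orthonormal polynomials (positive leading coefficients) with respect to $(x-c)^2d\mu$, and $\mathbf{J}_{[2]}$ is the semi-infinite symmetric tridiagonal (Jacobi) matrix with $x\bar{\mathbf{p}}^{[2]}=\mathbf{J}_{[2]}\bar{\mathbf{p}}^{[2]}$. $\mathbf{I}$ is the identity matrix. *)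

theory Defs
  imports "HOL-Analysis.Analysis" "HOL-Computational_Algebra.Polynomial"
begin

definition msupport :: "real measure \<Rightarrow> real set" where
  "msupport M = {x. \<forall>U. open U \<and> x \<in> U \<longrightarrow> emeasure M U > 0}"

text \<open>These conditions determine the sequence uniquely whenever it exists.\<close>

definition orthonormal_polys :: "real measure \<Rightarrow> (nat \<Rightarrow> real poly) \<Rightarrow> bool" where
  "orthonormal_polys N p \<longleftrightarrow>
     (\<forall>n. degree (p n) = n \<and> lead_coeff (p n) > 0) \<and>
     (\<forall>m n. integrable N (\<lambda>x. poly (p m) x * poly (p n) x) \<and>
            (\<integral>x. poly (p m) x * poly (p n) x \<partial>N) = (if m = n then 1 else 0))"

type_synonym smat = "nat \<Rightarrow> nat \<Rightarrow> real"

definition smat_id :: smat where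
  "smat_id i j = (if i = j then 1 else 0)"

definition smat_transpose :: "smat \<Rightarrow> smat" where
  "smat_transpose A i j = A j i"

text \<open>The entries of a product of semi-infinite matrices are series. Since \<open>suminf\<close> is
  unspecified for divergent series, \<open>smat_mult A B\<close> is only meaningful together with
  \<open>smat_mult_defined A B\<close>, which asks for absolute convergence of every entry.\<close>

definition smat_mult_defined :: "smat \<Rightarrow> smat \<Rightarrow> bool" where
  "smat_mult_defined A B \<longleftrightarrow> (\<forall>i j. summable (\<lambda>k. \<bar>A i k * B k j\<bar>))"

definition smat_mult :: "smat \<Rightarrow> smat \<Rightarrow> smat" where
  "smat_mult A B i j = (\<Sum>k. A i k * B k j)"

definition upper_triangular_smat :: "smat \<Rightarrow> bool" where
  "upper_triangular_smat A \<longleftrightarrow> (\<forall>i j. j < i \<longrightarrow> A i j = 0)"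

definition orthogonal_smat :: "smat \<Rightarrow> bool" where
  "orthogonal_smat Q \<longleftrightarrow>
     smat_mult_defined Q (smat_transpose Q) \<and> smat_mult Q (smat_transpose Q) = smat_id \<and>
     smat_mult_defined (smat_transpose Q) Q \<and> smat_mult (smat_transpose Q) Q = smat_id"

definition symmetric_smat :: "smat \<Rightarrow> bool" where
  "symmetric_smat A \<longleftrightarrow> smat_transpose A = A"

definition tridiagonal_smat :: "smat \<Rightarrow> bool" where
  "tridiagonal_smat A \<longleftrightarrow> (\<forall>i j. Suc i < j \<or> Suc j < i \<longrightarrow> A i j = 0)"

text \<open>The quadratic form is evaluated on finitely supported vectors, where it needs no
  convergence assumption; truncating at \<open>n\<close> reaches all of them.\<close>

definition positive_definite_smat :: "smat \<Rightarrow> bool" where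
  "positive_definite_smat A \<longleftrightarrow> symmetric_smat A \<and>
     (\<forall>n (v :: nat \<Rightarrow> real). (\<exists>i<n. v i \<noteq> 0) \<longrightarrow>
        (\<Sum>i<n. \<Sum>j<n. v i * A i j * v j) > 0)"

text \<open>The Jacobi matrix of a polynomial sequence: \<open>x p = J p\<close>, row by row. By
  tridiagonality each series has at most three nonzero terms.\<close>

definition jacobi_matrix_of :: "(nat \<Rightarrow> real poly) \<Rightarrow> smat \<Rightarrow> bool" where
  "jacobi_matrix_of p J \<longleftrightarrow> symmetric_smat J \<and> tridiagonal_smat J \<and>
     (\<forall>n x. (\<lambda>k. J n k * poly (p k) x) sums (x * poly (p n) x))"

end

theory Submission imports Defs begin

text \<open>The numbers \<open>\<psi> k = \<integral> (x - c) p2 k dM\<close> are the Fourier coefficients of \<open>1\<close> with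
  respect to the orthonormal system \<open>(x - c) p2 k\<close> of \<open>L\<^sup>2(M)\<close>, so they are square summable by
  Bessel's inequality; orthogonality of \<open>p2 i\<close> to \<open>p2 0\<close> says that \<open>A = J2 - c I\<close> maps \<open>\<psi>\<close> to a
  nonzero multiple of \<open>e\<^sub>0\<close>. The Gram--Schmidt process applied to \<open>\<psi>, e\<^sub>0, e\<^sub>1, \<dots>\<close> yields an
  orthonormal basis of \<open>\<ell>\<^sup>2\<close>. With \<open>Q\<close> having these vectors as rows, \<open>R = A Q\<^sup>T\<close> is upper
  triangular, because beyond the first \<open>j\<close> entries the \<open>j\<close>-th row of \<open>Q\<close> is proportional to
  \<open>\<psi>\<close>. Completeness of the basis holds even for indeterminate moment problems, where the rows
  \<open>\<integral> (x - c) p2 k p j dM\<close> built from the orthonormal polynomials \<open>p\<close> of \<open>M\<close> may fail to give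
  \<open>Q\<^sup>T Q = I\<close> (there the linear functional \<open>p \<mapsto> p(c)\<close> is bounded).\<close>

section \<open>Gram--Schmidt for a vector followed by the unit vectors\<close>

definition tail_sq :: "(nat \<Rightarrow> real) \<Rightarrow> nat \<Rightarrow> real" where
  "tail_sq \<psi> j = (\<Sum>k. (\<psi> (k + j))\<^sup>2)"

text \<open>Gram-Schmidt in closed form. Write T_j for \<open>tail_sq \<psi> j\<close>. The
  projection of e_m away from \<open>\<psi>\<close>, e_0, ..., e_(m-1) has entry T_(m+1) / T_m at m
  and -\<open>\<psi> m * \<psi> k\<close> / T_m at k > m; row \<open>Suc m\<close> is this vector
  normalised.\<close>

definition gs_smat :: "(nat \<Rightarrow> real) \<Rightarrow> smat" where
  "gs_smat \<psi> i k = (case i of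
      0 \<Rightarrow> \<psi> k / sqrt (tail_sq \<psi> 0)
    | Suc m \<Rightarrow> (if k < m then 0 else if k = m then tail_sq \<psi> (Suc m) else - \<psi> m * \<psi> k)
        / sqrt (tail_sq \<psi> m * tail_sq \<psi> (Suc m)))"

lemma gs_smat_0: "gs_smat \<psi> 0 k = \<psi> k / sqrt (tail_sq \<psi> 0)"
  by (simp add: gs_smat_def)

lemma gs_smat_Suc: "gs_smat \<psi> (Suc m) k =
    (if k < m then 0 else if k = m then tail_sq \<psi> (Suc m) else - \<psi> m * \<psi> k)
      / sqrt (tail_sq \<psi> m * tail_sq \<psi> (Suc m))"
  by (simp add: gs_smat_def)

text \<open>Columns therefore have finite support, which turns every sum over rows into a finite
  one.\<close>

lemma gs_smat_hessenberg: "Suc k < i \<Longrightarrow> gs_smat \<psi> i k = 0"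
  by (cases i) (auto simp: gs_smat_Suc)

text \<open>Row \<open>i\<close> lies in the span of \<open>\<psi>\<close>, e_0, ..., e_(i-1), so
  from column \<open>i\<close> on only its \<open>\<psi>\<close> component is visible.\<close>

lemma gs_smat_proportional: "\<exists>b. \<forall>k\<ge>i. gs_smat \<psi> i k = b * \<psi> k"
proof (cases i)
  case 0
  then show ?thesis
    by (intro exI[of _ "1 / sqrt (tail_sq \<psi> 0)"]) (simp add: gs_smat_0)
next
  case (Suc m)
  then show ?thesis
    by (intro exI[of _ "- \<psi> m / sqrt (tail_sq \<psi> m * tail_sq \<psi> (Suc m))"])
       (simp add: gs_smat_Suc)
qed

lemma tail_sq_sums:
  assumes "summable (\<lambda>k. (\<psi> k)\<^sup>2)"
  shows "(\<lambda>k. if k < j then 0 else (\<psi> k)\<^sup>2) sums tail_sq \<psi> j"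
proof -
  have "(\<lambda>k. (\<psi> (k + j))\<^sup>2) sums tail_sq \<psi> j"
    unfolding tail_sq_def using assms summable_iff_shift[of "\<lambda>k. (\<psi> k)\<^sup>2" j]
    by (auto intro: summable_sums)
  then have "(\<lambda>k. (\<lambda>k. if k < j then 0 else (\<psi> k)\<^sup>2) (k + j)) sums tail_sq \<psi> j"
    by simp
  then show ?thesis
    by (subst (asm) sums_iff_shift) simp
qed

lemma tail_sq_Suc:
  assumes "summable (\<lambda>k. (\<psi> k)\<^sup>2)"
  shows "tail_sq \<psi> j = (\<psi> j)\<^sup>2 + tail_sq \<psi> (Suc j)"
proof -
  have "(\<lambda>k. (if k = j then (\<psi> k)\<^sup>2 else 0) + (if k < Suc j then 0 else (\<psi> k)\<^sup>2)) sums
      ((\<psi> j)\<^sup>2 + tail_sq \<psi> (Suc j))"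
    by (intro sums_add tail_sq_sums assms sums_single[of j "\<lambda>k. (\<psi> k)\<^sup>2"])
  also have "(\<lambda>k. (if k = j then (\<psi> k)\<^sup>2 else 0) + (if k < Suc j then 0 else (\<psi> k)\<^sup>2))
      = (\<lambda>k. if k < j then 0 else (\<psi> k)\<^sup>2)"
    by auto
  finally show ?thesis
    using tail_sq_sums[OF assms, of j] sums_unique2 by blast
qed

lemma tail_sq_pos:
  assumes "summable (\<lambda>k. (\<psi> k)\<^sup>2)" and "j \<le> k" and "\<psi> k \<noteq> 0"
  shows "tail_sq \<psi> j > 0"
proof -
  have "summable (\<lambda>i. (\<psi> (i + j))\<^sup>2)"
    using assms(1) summable_iff_shift[of "\<lambda>k. (\<psi> k)\<^sup>2" j] by simp
  moreover have "(\<psi> ((k - j) + j))\<^sup>2 > 0"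
    using assms by simp
  ultimately show ?thesis
    unfolding tail_sq_def by (intro suminf_pos2[where i = "k - j"]) auto
qed

text \<open>The diagonal entry contributes \<open>\<psi> m * tail_sq \<psi> (Suc m)\<close> and the
  entries behind it contribute the negative of this.\<close>

lemma gs_smat_Suc_orthogonal:
  assumes "summable (\<lambda>k. (\<psi> k)\<^sup>2)"
  shows "(\<lambda>k. gs_smat \<psi> (Suc m) k * \<psi> k) sums 0"
proof -
  define s where "s = sqrt (tail_sq \<psi> m * tail_sq \<psi> (Suc m))"
  have "(\<lambda>k. ((if k = m then \<psi> k * tail_sq \<psi> (Suc m) else 0)
        - \<psi> m * (if k < Suc m then 0 else (\<psi> k)\<^sup>2)) / s) sums
      ((\<psi> m * tail_sq \<psi> (Suc m) - \<psi> m * tail_sq \<psi> (Suc m)) / s)"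
    by (intro sums_divide sums_diff sums_mult tail_sq_sums assms
        sums_single[of m "\<lambda>k. \<psi> k * tail_sq \<psi> (Suc m)"])
  also have "(\<lambda>k. ((if k = m then \<psi> k * tail_sq \<psi> (Suc m) else 0)
        - \<psi> m * (if k < Suc m then 0 else (\<psi> k)\<^sup>2)) / s)
      = (\<lambda>k. gs_smat \<psi> (Suc m) k * \<psi> k)"
    by (auto simp: gs_smat_Suc s_def power2_eq_square)
  finally show ?thesis by simp
qed

text \<open>The later row \<open>Suc m\<close> vanishes before column \<open>m\<close>, and from
  there on the earlier row is a multiple of \<open>\<psi>\<close>, so orthogonality to
  \<open>\<psi>\<close> suffices.\<close>

lemma gs_smat_rows_orthogonal:
  assumes "summable (\<lambda>k. (\<psi> k)\<^sup>2)" and "i < j"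
  shows "(\<lambda>k. gs_smat \<psi> j k * gs_smat \<psi> i k) sums 0"
proof -
  obtain m where m: "j = Suc m" "i \<le> m"
    using assms(2) by (cases j) auto
  obtain b where b: "\<And>k. k \<ge> i \<Longrightarrow> gs_smat \<psi> i k = b * \<psi> k"
    using gs_smat_proportional by blast
  have "gs_smat \<psi> j k * gs_smat \<psi> i k = b * (gs_smat \<psi> (Suc m) k * \<psi> k)" for k
    using m b[of k] by (cases "k < m") (auto simp: gs_smat_Suc)
  with sums_mult[OF gs_smat_Suc_orthogonal[OF assms(1)], of b m] show ?thesis
    by simp
qed

lemma gs_smat_rows_normalised:
  assumes sm: "summable (\<lambda>k. (\<psi> k)\<^sup>2)" and pos: "\<And>j. tail_sq \<psi> j > 0"
  shows "(\<lambda>k. gs_smat \<psi> i k * gs_smat \<psi> i k) sums 1"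
proof (cases i)
  case 0
  have "(\<lambda>k. (\<psi> k)\<^sup>2 / tail_sq \<psi> 0) sums (tail_sq \<psi> 0 / tail_sq \<psi> 0)"
    using tail_sq_sums[OF sm, of 0] by (intro sums_divide) simp
  moreover have "gs_smat \<psi> 0 k * gs_smat \<psi> 0 k = (\<psi> k)\<^sup>2 / tail_sq \<psi> 0" for k
    using pos[of 0] by (simp add: gs_smat_0 power2_eq_square)
  ultimately show ?thesis
    using 0 pos[of 0] by simp
next
  case (Suc m)
  define T where "T = tail_sq \<psi> m * tail_sq \<psi> (Suc m)"
  have T: "T > 0" using pos by (simp add: T_def)
  have "(\<lambda>k. ((if k = m then (tail_sq \<psi> (Suc m))\<^sup>2 else 0)
        + (\<psi> m)\<^sup>2 * (if k < Suc m then 0 else (\<psi> k)\<^sup>2)) / T) sums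
      (((tail_sq \<psi> (Suc m))\<^sup>2 + (\<psi> m)\<^sup>2 * tail_sq \<psi> (Suc m)) / T)"
    by (intro sums_divide sums_add sums_mult tail_sq_sums sm
        sums_single[of m "\<lambda>k. (tail_sq \<psi> (Suc m))\<^sup>2"])
  \<comment> \<open>Factor out \<open>tail_sq \<psi> (Suc m)\<close>; the other factor is
    \<open>tail_sq \<psi> m\<close> by \<open>tail_sq_Suc\<close>.\<close>
  also have "((tail_sq \<psi> (Suc m))\<^sup>2 + (\<psi> m)\<^sup>2 * tail_sq \<psi> (Suc m)) / T = 1"
    using T unfolding T_def tail_sq_Suc[OF sm, of m]
    by (simp add: field_simps power2_eq_square)
  also have "(\<lambda>k. ((if k = m then (tail_sq \<psi> (Suc m))\<^sup>2 else 0)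
        + (\<psi> m)\<^sup>2 * (if k < Suc m then 0 else (\<psi> k)\<^sup>2)) / T)
      = (\<lambda>k. gs_smat \<psi> i k * gs_smat \<psi> i k)"
    using T by (auto simp: Suc gs_smat_Suc T_def[symmetric] power2_eq_square fun_eq_iff)
  finally show ?thesis .
qed

lemma gs_smat_rows_abs_summable:
  assumes "summable (\<lambda>k. (\<psi> k)\<^sup>2)"
  shows "summable (\<lambda>k. \<bar>gs_smat \<psi> i k * gs_smat \<psi> j k\<bar>)"
proof -
  obtain a where a: "\<And>k. k \<ge> i \<Longrightarrow> gs_smat \<psi> i k = a * \<psi> k"
    using gs_smat_proportional by blast
  obtain b where b: "\<And>k. k \<ge> j \<Longrightarrow> gs_smat \<psi> j k = b * \<psi> k"
    using gs_smat_proportional by blast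
  have "\<bar>gs_smat \<psi> i k * gs_smat \<psi> j k\<bar> = \<bar>a * b\<bar> * (\<psi> k)\<^sup>2" if "k \<ge> max i j" for k
    using that a[of k] b[of k] by (simp add: abs_mult power2_eq_square)
  then have "\<forall>\<^sub>F k in sequentially. \<bar>gs_smat \<psi> i k * gs_smat \<psi> j k\<bar> = \<bar>a * b\<bar> * (\<psi> k)\<^sup>2"
    unfolding eventually_sequentially by blast
  from summable_cong[OF this] assms show ?thesis
    by (simp add: summable_mult)
qed

text \<open>The sum telescopes: as \<open>\<psi> m\<close> squared is T_m - T_(m+1), with T_j for
  \<open>tail_sq \<psi> j\<close>, row \<open>Suc m\<close> contributes
  \<open>\<psi> k * \<psi> l\<close> times 1 / T_(m+1) - 1 / T_m.\<close>

lemma gs_smat_column_partial_sum: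
  assumes sm: "summable (\<lambda>k. (\<psi> k)\<^sup>2)" and pos: "\<And>j. tail_sq \<psi> j > 0"
    and "m \<le> k" "m \<le> l"
  shows "(\<Sum>i\<le>m. gs_smat \<psi> i k * gs_smat \<psi> i l) = \<psi> k * \<psi> l / tail_sq \<psi> m"
  using assms(3,4)
proof (induction m)
  case 0
  show ?case
    using pos[of 0] by (simp add: gs_smat_0)
next
  case (Suc m)
  have p: "tail_sq \<psi> m > 0" "tail_sq \<psi> (Suc m) > 0"
    using pos by auto
  have "gs_smat \<psi> (Suc m) k * gs_smat \<psi> (Suc m) l
      = (\<psi> m)\<^sup>2 * (\<psi> k * \<psi> l) / (tail_sq \<psi> m * tail_sq \<psi> (Suc m))"
    using Suc.prems p by (simp add: gs_smat_Suc power2_eq_square)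
  also have "(\<psi> m)\<^sup>2 = tail_sq \<psi> m - tail_sq \<psi> (Suc m)"
    using tail_sq_Suc[OF sm, of m] by simp
  finally have step: "gs_smat \<psi> (Suc m) k * gs_smat \<psi> (Suc m) l
      = (tail_sq \<psi> m - tail_sq \<psi> (Suc m)) * (\<psi> k * \<psi> l)
        / (tail_sq \<psi> m * tail_sq \<psi> (Suc m))" .
  have IH: "(\<Sum>i\<le>m. gs_smat \<psi> i k * gs_smat \<psi> i l) = \<psi> k * \<psi> l / tail_sq \<psi> m"
    using Suc by simp
  show ?case
    unfolding sum.atMost_Suc IH step using p by (simp add: field_simps)
qed

text \<open>This is completeness of the rows, reduced to a finite identity: column \<open>k\<close>
  ends at row \<open>Suc k\<close>, whose special diagonal entry closes the telescoping sum.\<close>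

lemma gs_smat_columns_orthonormal:
  assumes sm: "summable (\<lambda>k. (\<psi> k)\<^sup>2)" and pos: "\<And>j. tail_sq \<psi> j > 0"
    and "k \<le> l"
  shows "(\<Sum>i\<le>Suc k. gs_smat \<psi> i k * gs_smat \<psi> i l) = (if k = l then 1 else 0)"
proof -
  have p: "tail_sq \<psi> k > 0" "tail_sq \<psi> (Suc k) > 0"
    using pos by auto
  have "(\<Sum>i\<le>Suc k. gs_smat \<psi> i k * gs_smat \<psi> i l)
      = \<psi> k * \<psi> l / tail_sq \<psi> k + gs_smat \<psi> (Suc k) k * gs_smat \<psi> (Suc k) l"
    using gs_smat_column_partial_sum[OF sm pos, of k k l] assms(3) by simp
  also have "\<dots> = (if k = l then 1 else 0)"
  proof (cases "k = l")
    case True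
    have "gs_smat \<psi> (Suc k) k * gs_smat \<psi> (Suc k) k = tail_sq \<psi> (Suc k) / tail_sq \<psi> k"
      using p by (simp add: gs_smat_Suc)
    moreover have "((\<psi> k)\<^sup>2 + tail_sq \<psi> (Suc k)) / tail_sq \<psi> k = 1"
      using p tail_sq_Suc[OF sm, of k] by simp
    ultimately show ?thesis
      using True by (simp add: power2_eq_square add_divide_distrib)
  next
    case False
    then show ?thesis
      using p assms(3) by (simp add: gs_smat_Suc field_simps)
  qed
  finally show ?thesis .
qed

lemma gs_smat_columns_sums:
  assumes sm: "summable (\<lambda>k. (\<psi> k)\<^sup>2)" and pos: "\<And>j. tail_sq \<psi> j > 0"
  shows "(\<lambda>i. gs_smat \<psi> i k * gs_smat \<psi> i l) sums (if k = l then 1 else 0)"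
proof -
  have *: "(\<lambda>i. gs_smat \<psi> i k * gs_smat \<psi> i l) sums (if k = l then 1 else 0)"
    if "k \<le> l" for k l
  proof -
    have "(\<lambda>i. gs_smat \<psi> i k * gs_smat \<psi> i l) sums
        (\<Sum>i\<le>Suc k. gs_smat \<psi> i k * gs_smat \<psi> i l)"
      by (intro sums_finite) (auto simp: gs_smat_hessenberg)
    then show ?thesis
      using gs_smat_columns_orthonormal[OF sm pos that] by simp
  qed
  show ?thesis
    using *[of k l] *[of l k] by (cases "k \<le> l") (auto simp: mult.commute)
qed

lemma gs_smat_orthogonal:
  assumes sm: "summable (\<lambda>k. (\<psi> k)\<^sup>2)" and pos: "\<And>j. tail_sq \<psi> j > 0"
  shows "orthogonal_smat (gs_smat \<psi>)"
  unfolding orthogonal_smat_def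
proof (intro conjI)
  show "smat_mult_defined (gs_smat \<psi>) (smat_transpose (gs_smat \<psi>))"
    using gs_smat_rows_abs_summable[OF sm]
    by (simp add: smat_mult_defined_def smat_transpose_def)
  have "(\<lambda>k. gs_smat \<psi> i k * gs_smat \<psi> j k) sums smat_id i j" for i j
    using gs_smat_rows_orthogonal[OF sm, of i j] gs_smat_rows_orthogonal[OF sm, of j i]
      gs_smat_rows_normalised[OF sm pos, of i]
    by (cases i j rule: linorder_cases) (auto simp: smat_id_def mult.commute)
  then show "smat_mult (gs_smat \<psi>) (smat_transpose (gs_smat \<psi>)) = smat_id"
    by (auto simp: fun_eq_iff smat_mult_def smat_transpose_def sums_iff)
  show "smat_mult_defined (smat_transpose (gs_smat \<psi>)) (gs_smat \<psi>)"
    unfolding smat_mult_defined_def smat_transpose_def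
  proof (intro allI)
    fix k l
    show "summable (\<lambda>i. \<bar>gs_smat \<psi> i k * gs_smat \<psi> i l\<bar>)"
      by (rule summable_finite[of "{..Suc k}"]) (auto simp: gs_smat_hessenberg)
  qed
  show "smat_mult (smat_transpose (gs_smat \<psi>)) (gs_smat \<psi>) = smat_id"
    using gs_smat_columns_sums[OF sm pos]
    by (auto simp: fun_eq_iff smat_mult_def smat_transpose_def sums_iff smat_id_def)
qed

text \<open>Once \<open>A\<close> maps \<open>\<psi>\<close> to a multiple of e_0, the matrix R = A
  Q^T is upper triangular, and R Q = A Q^T Q = A.\<close>

lemma tridiagonal_RQ_factorisation:
  assumes tri: "tridiagonal_smat A"
    and sm: "summable (\<lambda>k. (\<psi> k)\<^sup>2)" and pos: "\<And>j. tail_sq \<psi> j > 0"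
    and ker: "\<And>i. i > 0 \<Longrightarrow> (\<Sum>k\<le>Suc i. A i k * \<psi> k) = 0"
  shows "\<exists>R Q. upper_triangular_smat R \<and> orthogonal_smat Q \<and> smat_mult_defined R Q \<and>
    A = smat_mult R Q"
proof (intro exI conjI)
  define Q where "Q = gs_smat \<psi>"
  define R where "R = (\<lambda>i j. \<Sum>k\<le>Suc i. A i k * Q j k)"
  show "orthogonal_smat Q"
    unfolding Q_def by (rule gs_smat_orthogonal[OF sm pos])
  show "upper_triangular_smat R"
    unfolding upper_triangular_smat_def
  proof (intro allI impI)
    fix i j :: nat
    assume ji: "j < i"
    obtain b where b: "\<And>k. k \<ge> j \<Longrightarrow> Q j k = b * \<psi> k"
      using gs_smat_proportional Q_def by blast
    \<comment> \<open>Row \<open>i\<close> of \<open>A\<close> starts at column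
      \<open>i - 1\<close>, which is at least \<open>j\<close>, so it meets row \<open>j\<close> of
      \<open>Q\<close> only where that row is a multiple of \<open>\<psi>\<close>.\<close>
    have eq: "A i k * Q j k = b * (A i k * \<psi> k)" for k
    proof (cases "k < j")
      case True
      then have "A i k = 0"
        using tri ji by (simp add: tridiagonal_smat_def)
      then show ?thesis by simp
    qed (simp add: b)
    have "R i j = b * (\<Sum>k\<le>Suc i. A i k * \<psi> k)"
      unfolding R_def sum_distrib_left by (simp only: eq)
    then show "R i j = 0"
      using ker[of i] ji by simp
  qed
  have Q0: "Q k j = 0" if "k \<notin> {..Suc j}" for k j
    using that by (simp add: Q_def gs_smat_hessenberg)
  show "smat_mult_defined R Q"
    unfolding smat_mult_defined_def
  proof (intro allI)
    fix i j
    show "summable (\<lambda>k. \<bar>R i k * Q k j\<bar>)"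
      by (rule summable_finite[of "{..Suc j}"]) (simp_all add: Q0)
  qed
  have "(\<lambda>k. R i k * Q k j) sums A i j" for i j
  proof -
    \<comment> \<open>Associativity of the product: the sum over \<open>l\<close> is finite, so it
      may be interchanged with the series over \<open>k\<close>.\<close>
    have "(\<lambda>k. \<Sum>l\<le>Suc i. A i l * (Q k l * Q k j)) sums
        (\<Sum>l\<le>Suc i. A i l * (if l = j then 1 else 0))"
      unfolding Q_def by (intro sums_sum sums_mult gs_smat_columns_sums[OF sm pos])
    moreover have "(\<Sum>l\<le>Suc i. A i l * (if l = j then 1 else 0)) = A i j"
      using tri by (auto simp: tridiagonal_smat_def if_distrib[of "(*) _"] sum.delta' not_le
          cong: if_cong simp del: sum.atMost_Suc)
    moreover have "(\<Sum>l\<le>Suc i. A i l * (Q k l * Q k j)) = R i k * Q k j" for k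
      by (simp add: R_def sum_distrib_right mult.assoc del: sum.atMost_Suc)
    ultimately show ?thesis by simp
  qed
  then show "A = smat_mult R Q"
    by (auto simp: fun_eq_iff smat_mult_def sums_iff)
qed

section \<open>Measures with finite moments\<close>

lemma integrable_poly_of_moments:
  fixes M :: "real measure" and p :: "real poly"
  assumes "\<And>n. integrable M (\<lambda>x. x ^ n)"
  shows "integrable M (poly p)"
proof -
  have "integrable M (\<lambda>x. \<Sum>i\<le>degree p. coeff p i * x ^ i)"
    using assms by (intro Bochner_Integration.integrable_sum integrable_mult_right) auto
  then show ?thesis
    by (simp add: poly_altdef[abs_def])
qed

text \<open>The complement of the support is a union of open null sets; by Lindelof countably many
  of them cover it.\<close>

lemma AE_in_msupport:
  assumes "sets M = sets borel"
  shows "AE x in M. x \<in> msupport M"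
proof -
  define F where "F = {U. open U \<and> emeasure M U = 0}"
  obtain F' where F': "F' \<subseteq> F" "countable F'" "\<Union>F' = \<Union>F"
    using Lindelof[of F] by (auto simp: F_def)
  have "\<Union>F' \<in> null_sets M"
    using F' assms
    by (intro null_sets_UN'[of F' "\<lambda>U. U", simplified]) (auto simp: F_def null_sets_def)
  moreover have "{x \<in> space M. x \<notin> msupport M} \<subseteq> \<Union>F'"
    unfolding F'(3) by (auto simp: F_def msupport_def)
  ultimately show ?thesis
    by (rule AE_I')
qed

text \<open>A zero integral would make \<open>p\<close> vanish almost everywhere. An infinite
  support contains a non-root of \<open>p\<close>, and the open set of non-roots then has positive
  measure.\<close>

lemma integral_poly_pos:
  fixes M :: "real measure" and p :: "real poly"
  assumes sets: "sets M = sets borel" and inf: "infinite (msupport M)"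
    and int: "integrable M (poly p)" and "p \<noteq> 0"
    and nonneg: "\<And>x. x \<in> msupport M \<Longrightarrow> poly p x \<ge> 0"
  shows "(\<integral>x. poly p x \<partial>M) > 0"
proof -
  have ae: "AE x in M. 0 \<le> poly p x"
    using AE_in_msupport[OF sets] by eventually_elim (rule nonneg)
  have "(\<integral>x. poly p x \<partial>M) \<noteq> 0"
  proof
    assume "(\<integral>x. poly p x \<partial>M) = 0"
    then have zero: "AE x in M. poly p x = 0"
      using integral_nonneg_eq_0_iff_AE[OF int ae] by simp
    obtain x where x: "x \<in> msupport M" "poly p x \<noteq> 0"
      using inf poly_roots_finite[OF \<open>p \<noteq> 0\<close>]
      by (metis (mono_tags, lifting) finite_subset mem_Collect_eq subsetI)
    have "open {x. poly p x \<noteq> 0}"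
      by (intro open_Collect_neq continuous_intros)
    then have "emeasure M {x. poly p x \<noteq> 0} > 0"
      using x by (auto simp: msupport_def)
    moreover have "emeasure M {x. poly p x \<noteq> 0} = 0"
      using zero \<open>open {x. poly p x \<noteq> 0}\<close> sets
      by (subst (asm) AE_iff_measurable[of "{x. poly p x \<noteq> 0}"])
         (auto simp: sets_eq_imp_space_eq[OF sets])
    ultimately show False by simp
  qed
  then show ?thesis
    using integral_nonneg_AE[OF ae] by simp
qed

section \<open>The shifted Jacobi matrix\<close>

lemma smult_sum_right: "smult a (\<Sum>i\<in>S. f i) = (\<Sum>i\<in>S. smult a (f i))"
  by (induction S rule: infinite_finite_induct) (simp_all add: smult_add_right)

text \<open>Tridiagonality truncates the series, and agreement at all real points gives an identity
  of polynomials, to which linear functionals can be applied.\<close>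

lemma jacobi_matrix_shifted_recurrence:
  assumes "jacobi_matrix_of p J"
  shows "[:-c, 1:] * p n = (\<Sum>k\<le>Suc n. smult (J n k - c * smat_id n k) (p k))"
proof -
  have "poly ([:-c, 1:] * p n) x = poly (\<Sum>k\<le>Suc n. smult (J n k - c * smat_id n k) (p k)) x"
    for x
  proof -
    have "(\<lambda>k. J n k * poly (p k) x) sums (\<Sum>k\<le>Suc n. J n k * poly (p k) x)"
      using assms by (intro sums_finite) (auto simp: jacobi_matrix_of_def tridiagonal_smat_def)
    then have "x * poly (p n) x = (\<Sum>k\<le>Suc n. J n k * poly (p k) x)"
      using assms sums_unique2 unfolding jacobi_matrix_of_def by blast
    moreover have "(\<Sum>k\<le>Suc n. c * smat_id n k * poly (p k) x) = c * poly (p n) x"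
      by (simp add: smat_id_def if_distrib[of "\<lambda>z. c * z * _"] sum.delta'
          cong: if_cong)
    ultimately show ?thesis
      by (simp add: poly_sum left_diff_distrib sum_subtractf algebra_simps
          del: sum.atMost_Suc)
  qed
  then show ?thesis
    by (simp add: poly_eq_poly_eq_iff[symmetric] fun_eq_iff del: sum.atMost_Suc)
qed

text \<open>Otherwise x times \<open>p n\<close> would be a combination of \<open>p 0\<close>, ...,
  \<open>p n\<close>, whose degree is too small.\<close>

lemma jacobi_matrix_superdiagonal_nonzero:
  assumes "jacobi_matrix_of p J" and deg: "\<And>n. degree (p n) = n" and nz: "p n \<noteq> 0"
  shows "J n (Suc n) \<noteq> 0"
proof
  assume "J n (Suc n) = 0"
  then have "[:0, 1:] * p n = (\<Sum>k\<le>n. smult (J n k) (p k))"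
    using jacobi_matrix_shifted_recurrence[OF assms(1), of 0 n] by simp
  moreover have "degree (\<Sum>k\<le>n. smult (J n k) (p k)) \<le> n"
    by (intro degree_sum_le) (auto simp: deg)
  moreover have "degree ([:0, 1:] * p n) = Suc n"
    using nz deg by (simp add: degree_mult_eq)
  ultimately show False by simp
qed

theorem proposition3:
  fixes M :: "real measure" and E :: "real set" and c :: real
    and p2 :: "nat \<Rightarrow> real poly" and J2 :: smat
  assumes "sets M = sets borel"
    and "is_interval E"
    and "infinite (msupport M)"
    and "msupport M \<subseteq> E"
    and "\<And>n. integrable M (\<lambda>x. x ^ n)"
    and "\<And>x. x \<in> E \<Longrightarrow> c < x"
    and "orthonormal_polys (density M (\<lambda>x. ennreal ((x - c)\<^sup>2))) p2"
    and "jacobi_matrix_of p2 J2"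
  shows "positive_definite_smat (\<lambda>i j. J2 i j - c * smat_id i j) \<and>
    (\<exists>R Q. upper_triangular_smat R \<and> orthogonal_smat Q \<and> smat_mult_defined R Q \<and>
       (\<lambda>i j. J2 i j - c * smat_id i j) = smat_mult R Q)"
proof -
  define A :: smat where "A = (\<lambda>i j. J2 i j - c * smat_id i j)"
  define d :: "real poly" where "d = [:-c, 1:]"
  \<comment> \<open>All integrals are handled through this moment functional, which is linear on all
    polynomials because every moment is finite.\<close>
  define L :: "real poly \<Rightarrow> real" where "L = (\<lambda>p. \<integral>x. poly p x \<partial>M)"
  define \<psi> where "\<psi> = (\<lambda>k. L (d * p2 k))"
  note int = integrable_poly_of_moments[OF assms(5)]
  have L_add: "L (p + q) = L p + L q" for p q
    using Bochner_Integration.integral_add[OF int[of p] int[of q]]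
    by (simp add: L_def poly_add[abs_def])
  have L_smult: "L (smult a p) = a * L p" for a p
    using integral_mult_right_zero[of M a "poly p"] by (simp add: L_def poly_smult[abs_def])
  have L_diff: "L (p - q) = L p - L q" for p q
    using L_add[of "p - q" q] by simp
  have L_0: "L 0 = 0"
    using L_smult[of 0 0] by simp
  have L_sum: "L (\<Sum>i\<in>I. f i) = (\<Sum>i\<in>I. L (f i))" for I and f :: "nat \<Rightarrow> real poly"
    by (induction I rule: infinite_finite_induct) (simp_all add: L_0 L_add)
  have meas: "poly p \<in> borel_measurable M" for p
    using int[of p] by simp
  \<comment> \<open>Splitting the weight evenly between the two factors makes the
    \<open>d * p2 k\<close> orthonormal with respect to \<open>M\<close> itself.\<close>
  have ortho: "L ((d * p2 m) * (d * p2 n)) = (if m = n then 1 else 0)" for m n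
  proof -
    have "(\<lambda>x. (x - c)\<^sup>2) = poly (d * d)"
      by (simp add: fun_eq_iff d_def power2_eq_square algebra_simps)
    then have "(\<lambda>x. (x - c)\<^sup>2) \<in> borel_measurable M"
      by (simp only: meas)
    then have "(\<integral>x. poly (p2 m * p2 n) x \<partial>density M (\<lambda>x. ennreal ((x - c)\<^sup>2)))
        = (\<integral>x. (x - c)\<^sup>2 * poly (p2 m * p2 n) x \<partial>M)"
      using meas by (subst integral_real_density) (auto)
    also have "\<dots> = L ((d * p2 m) * (d * p2 n))"
      unfolding L_def
      by (intro Bochner_Integration.integral_cong) (simp_all add: d_def power2_eq_square algebra_simps)
    finally show ?thesis
      using assms(7) by (simp add: orthonormal_polys_def)
  qed
  have deg: "degree (p2 n) = n" and nz: "p2 n \<noteq> 0" for n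
    using assms(7) unfolding orthonormal_polys_def by (blast, metis leading_coeff_0_iff less_irrefl)
  have rec: "d * p2 n = (\<Sum>k\<le>Suc n. smult (A n k) (p2 k))" for n
    unfolding A_def d_def by (rule jacobi_matrix_shifted_recurrence[OF assms(8)])
  have symJ: "J2 i j = J2 j i" for i j
    using assms(8) by (metis jacobi_matrix_of_def symmetric_smat_def smat_transpose_def)
  have symA: "symmetric_smat A"
    by (auto simp: symmetric_smat_def smat_transpose_def A_def smat_id_def symJ fun_eq_iff)
  have triA: "tridiagonal_smat A"
    using assms(8) by (auto simp: tridiagonal_smat_def A_def smat_id_def jacobi_matrix_of_def)
  \<comment> \<open>\<open>A\<close> represents multiplication by x - c in the orthonormal system
    \<open>d * p2 k\<close>.\<close>
  have A_entry: "L ((d * (d * p2 i)) * (d * p2 j)) = A i j" for i j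
  proof -
    have "L ((d * (d * p2 i)) * (d * p2 j))
        = L (\<Sum>k\<le>Suc i. smult (A i k) ((d * p2 k) * (d * p2 j)))"
      unfolding rec[of i] by (simp add: sum_distrib_left sum_distrib_right algebra_simps
          del: sum.atMost_Suc)
    also have "\<dots> = (\<Sum>k\<le>Suc i. A i k * (if k = j then 1 else 0))"
      by (simp add: L_sum L_smult ortho del: sum.atMost_Suc)
    also have "\<dots> = A i j"
      using triA by (auto simp: tridiagonal_smat_def if_distrib[of "(*) _"] sum.delta' not_le
          cong: if_cong simp del: sum.atMost_Suc)
    finally show ?thesis .
  qed
  have posdef: "positive_definite_smat A"
    unfolding positive_definite_smat_def
  proof (intro conjI symA allI impI)
    fix n and v :: "nat \<Rightarrow> real"
    assume v: "\<exists>i<n. v i \<noteq> 0"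
    define P where "P = (\<Sum>i<n. smult (v i) (p2 i))"
    \<comment> \<open>The quadratic form is the integral of (x - c)^3 P^2, and the cube is positive
      on the support because \<open>c\<close> lies to its left.\<close>
    have "L (d * d * d * P * P) =
        L (\<Sum>i<n. \<Sum>j<n. smult (v i * v j) ((d * (d * p2 i)) * (d * p2 j)))"
      by (simp add: P_def smult_sum_right sum_distrib_left sum_distrib_right algebra_simps)
    also have "\<dots> = (\<Sum>i<n. \<Sum>j<n. v i * A i j * v j)"
      by (simp only: L_sum L_smult A_entry) (simp add: mult_ac)
    finally have *: "L (d * d * d * P * P) = (\<Sum>i<n. \<Sum>j<n. v i * A i j * v j)" .
    have "P \<noteq> 0"
    proof
      assume "P = 0"
      obtain m where m: "m < n" "v m \<noteq> 0"
        using v by blast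
      have "L ((d * P) * (d * p2 m)) = L (\<Sum>i<n. smult (v i) ((d * p2 i) * (d * p2 m)))"
        by (simp add: P_def smult_sum_right sum_distrib_left sum_distrib_right algebra_simps)
      also have "\<dots> = v m"
        using m by (simp add: L_sum L_smult ortho if_distrib[of "(*) _"] cong: if_cong)
      finally show False
        using \<open>P = 0\<close> m by (simp add: L_0)
    qed
    moreover have "d \<noteq> 0"
      by (simp add: d_def)
    ultimately have "d * d * d * P * P \<noteq> 0"
      by simp
    moreover have "poly (d * d * d * P * P) x \<ge> 0" if "x \<in> msupport M" for x
    proof -
      have "poly d x = x - c"
        by (simp add: d_def)
      then have "poly (d * d * d * P * P) x = (x - c) ^ 3 * (poly P x)\<^sup>2"
        by (simp add: power2_eq_square power3_eq_cube)
      then show ?thesis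
        using that assms(4,6) by (simp add: subset_eq less_imp_le)
    qed
    ultimately have "L (d * d * d * P * P) > 0"
      unfolding L_def by (intro integral_poly_pos assms(1,3) int)
    then show "(\<Sum>i<n. \<Sum>j<n. v i * A i j * v j) > 0"
      using * by simp
  qed
  have A_psi: "(\<Sum>k\<le>Suc i. A i k * \<psi> k) = L (d * (d * p2 i))" for i
    unfolding rec[of i] \<psi>_def
    by (simp add: L_sum L_smult sum_distrib_left del: sum.atMost_Suc)
  obtain a where a: "p2 0 = [:a:]" "a \<noteq> 0"
    using deg[of 0] nz[of 0] by (metis degree_eq_zeroE pCons_0_0)
  \<comment> \<open>As \<open>p2 0\<close> is the constant \<open>a\<close>, the left side is the
    inner product of \<open>d * p2 i\<close> with \<open>d * p2 0\<close>.\<close>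
  have A_psi': "a * (\<Sum>k\<le>Suc i. A i k * \<psi> k) = (if i = 0 then 1 else 0)" for i
    using ortho[of i 0] unfolding A_psi
    by (simp add: a L_smult[symmetric] algebra_simps)
  have ker: "(\<Sum>k\<le>Suc i. A i k * \<psi> k) = 0" if "i > 0" for i
    using A_psi'[of i] a that by simp
  have sm: "summable (\<lambda>k. (\<psi> k)\<^sup>2)"
  proof (rule summableI_nonneg_bounded)
    fix n
    define S where "S = (\<Sum>k<n. smult (\<psi> k) (d * p2 k))"
    have S1: "L S = (\<Sum>k<n. (\<psi> k)\<^sup>2)"
      by (simp add: S_def L_sum L_smult \<psi>_def[symmetric] power2_eq_square
          del: mult_smult_right) (simp add: \<psi>_def)
    have "L (S * S) = L (\<Sum>i<n. \<Sum>j<n. smult (\<psi> i * \<psi> j) ((d * p2 i) * (d * p2 j)))"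
      by (simp add: S_def smult_sum_right sum_distrib_left sum_distrib_right algebra_simps)
    also have "\<dots> = (\<Sum>k<n. (\<psi> k)\<^sup>2)"
      by (simp only: L_sum L_smult ortho)
         (simp add: if_distrib[of "(*) _"] power2_eq_square cong: if_cong)
    finally have SS: "L (S * S) = (\<Sum>k<n. (\<psi> k)\<^sup>2)" .
    \<comment> \<open>Bessel's inequality: \<open>L S\<close> and \<open>L (S * S)\<close> are the
      same partial sum, so expanding the square leaves \<open>L 1\<close> minus that sum.\<close>
    have "0 \<le> L ((1 - S) * (1 - S))"
      unfolding L_def by (intro Bochner_Integration.integral_nonneg) simp
    also have "(1 - S) * (1 - S) = 1 - S - S + S * S"
      by (simp add: algebra_simps)
    finally show "(\<Sum>k<n. (\<psi> k)\<^sup>2) \<le> L 1"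
      by (simp only: L_add L_diff S1 SS)
  qed simp
  \<comment> \<open>All tails of \<open>\<psi>\<close> must be nonzero for the Gram-Schmidt
    denominators to be positive. If \<open>\<psi> j\<close> were the last nonzero entry, row
    \<open>Suc j\<close> of \<open>A\<close> applied to \<open>\<psi>\<close> would reduce to
    \<open>A (Suc j) j * \<psi> j\<close>, a nonzero number, against \<open>ker\<close>.\<close>
  have "\<exists>k\<ge>j. \<psi> k \<noteq> 0" for j
  proof (induction j)
    case 0
    show ?case
      using A_psi'[of 0] by (intro ccontr[of "\<exists>k\<ge>0. \<psi> k \<noteq> 0"]) auto
  next
    case (Suc j)
    show ?case
    proof (rule ccontr)
      assume "\<not> ?case"
      then have z: "\<psi> k = 0" if "k > j" for k
        using that Suc_le_eq by blast
      with Suc have "\<psi> j \<noteq> 0"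
        by (metis le_neq_implies_less)
      have "(\<Sum>k\<le>Suc (Suc j). A (Suc j) k * \<psi> k) = (\<Sum>k\<in>{j}. A (Suc j) k * \<psi> k)"
        using z triA by (intro sum.mono_neutral_right)
          (auto simp: tridiagonal_smat_def, metis Suc_less_eq linorder_neqE_nat)
      then have "A (Suc j) j * \<psi> j = 0"
        using ker[of "Suc j"] by simp
      moreover have "A (Suc j) j = J2 j (Suc j)"
        by (simp add: A_def smat_id_def symJ)
      ultimately show False
        using jacobi_matrix_superdiagonal_nonzero[OF assms(8) deg nz, of j] \<open>\<psi> j \<noteq> 0\<close>
        by simp
    qed
  qed
  then have "tail_sq \<psi> j > 0" for j
    using tail_sq_pos[OF sm] by blast
  then show ?thesis
    using posdef tridiagonal_RQ_factorisation[OF triA sm _ ker] by (simp add: A_def)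
qed

end
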